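(* Let $a, b, L_h$ satisfy $a\in(0,1)$, $b\in(0,1)$, $L_h\in(0,1)$ and $aL_h<b$. Let $\mathbf{f}:\mathbb{R}^u\times\mathbb{R}^v\to\mathbb{R}^v$ be Lipschitz with constant $L_x$ in its first argument and Lipschitz with constant $L_h$ in its second argument, with $\mathbf{f}(\mathbf{0}_u,\mathbf{0}_v)=\mathbf{0}_v$. Then for the ODE $$\frac{d\mathbf{h}(t)}{dt}=a\,\mathbf{f}(\hat{\mathbf{x}}(t),\mathbf{h}(t))-b\,\mathbf{h}(t)$$ it holds that $$\frac{d}{d\tau}\left\|\frac{d\mathbf{h}(t+\tau)}{dh_i(t)}\right\|_2<0 .$$
   Context: Here $\hat{\mathbf{x}}(t)\in\mathbb{R}^u$ is the input signal (an interpolation of an input time series), $\mathbf{h}(t)\in\mathbb{R}^v$ is the solution of the ODE, $h_i(t)$ is the $i$-th coordinate of $\mathbf{h}(t)$, $t$ is a time, $\tau$ is the time elapsed after $t$, and $\frac{d\mathbf{h}(t+\tau)}{dh_i(t)}\in\mathbb{R}^v$ is the derivative of the solution at time $t+\tau$ with respect to the $i$-th coordinate of its value at time $t$.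
   Formalization: Since f is only Lipschitz, the derivatives need not exist; the formal theorem assumes that dh(t+τ)/dh_i(t) exists for elapsed times near τ ≥ 0 and that its norm is differentiable in τ there (one-sided at τ = 0). *)

theory Defs
  imports "HOL-Analysis.Analysis"
begin

definition ode_solution_on ::
  "real set \<Rightarrow> real \<Rightarrow> real \<Rightarrow> (real ^ 'u \<Rightarrow> real ^ 'v \<Rightarrow> real ^ 'v) \<Rightarrow> (real \<Rightarrow> real ^ 'u)
    \<Rightarrow> (real \<Rightarrow> real ^ 'v) \<Rightarrow> bool"
  where
  "ode_solution_on S a b f x h \<longleftrightarrow>
    (\<forall>s\<in>S. (h has_vector_derivative (a *\<^sub>R f (x s) (h s) - b *\<^sub>R h s)) (at s within S))"

text \<open>The solution as a function of its value at time \<open>t\<close>: \<open>H p s\<close> is the value at time \<open>s\<close> of a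
  solution on \<open>[t, \<infinity>)\<close> whose value at time \<open>t\<close> is \<open>p\<close>. Without this dependence on \<open>p\<close>, the derivative
  of \<open>h(t + \<tau>)\<close> with respect to a coordinate of \<open>h(t)\<close> has no meaning.\<close>

definition solution_family ::
  "real \<Rightarrow> real \<Rightarrow> real \<Rightarrow> (real ^ 'u \<Rightarrow> real ^ 'v \<Rightarrow> real ^ 'v) \<Rightarrow> (real \<Rightarrow> real ^ 'u)
    \<Rightarrow> (real ^ 'v \<Rightarrow> real \<Rightarrow> real ^ 'v) \<Rightarrow> bool"
  where
  "solution_family t a b f x H \<longleftrightarrow> (\<forall>p. H p t = p \<and> ode_solution_on {t..} a b f x (H p))"

text \<open>The state at time \<open>t + \<tau>\<close> after adding \<open>r\<close> to the \<open>i\<close>-th coordinate of the state \<open>p\<close> at time \<open>t\<close>.\<close>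

definition perturbed_state ::
  "(real ^ 'v \<Rightarrow> real \<Rightarrow> real ^ 'v) \<Rightarrow> real \<Rightarrow> real ^ 'v \<Rightarrow> 'v \<Rightarrow> real \<Rightarrow> real \<Rightarrow> real ^ 'v"
  where
  "perturbed_state H t p i \<tau> r = H (p + r *\<^sub>R axis i 1) (t + \<tau>)"

text \<open>The partial derivative of \<open>h(t + \<tau>)\<close> with respect to \<open>h\<^sub>i(t)\<close> at \<open>h(t) = p\<close>. It is meaningful
  only where \<^term>\<open>perturbed_state H t p i \<tau>\<close> is differentiable at \<open>0\<close>, which a merely Lipschitz \<open>f\<close>
  does not guarantee.\<close>

definition sensitivity ::
  "(real ^ 'v \<Rightarrow> real \<Rightarrow> real ^ 'v) \<Rightarrow> real \<Rightarrow> real ^ 'v \<Rightarrow> 'v \<Rightarrow> real \<Rightarrow> real ^ 'v"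
  where
  "sensitivity H t p i \<tau> = vector_derivative (perturbed_state H t p i \<tau>) (at 0)"

end

theory Submission
  imports Defs
begin

text \<open>By the Lipschitz bound on \<open>f\<close>, the squared distance \<open>u\<close> of two solutions satisfies
  \<open>- 2 (a L\<^sub>h + b) u \<le> u' \<le> 2 (a L\<^sub>h - b) u\<close>. By Gronwall's inequality the distance is bounded
  above and below by exponentials. Dividing by the initial perturbation \<open>r\<close> and letting \<open>r \<rightarrow> 0\<close>
  passes both bounds to the norm \<open>N\<close> of the sensitivity: \<open>N > 0\<close> and
  \<open>N \<sigma> \<le> exp ((a L\<^sub>h - b) (\<sigma> - \<tau>)) N \<tau>\<close> for \<open>\<sigma> \<ge> \<tau>\<close>. With equality at \<open>\<sigma> = \<tau>\<close>, the derivative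
  at \<open>\<tau>\<close> is at most \<open>(a L\<^sub>h - b) N \<tau> < 0\<close>.\<close>

text \<open>The product of \<open>u s\<close> with the integrating factor
  \<open>exp (- m * (s - s\<^sub>1))\<close> has nonpositive derivative, hence does not increase.
  Differentiability is asked only in the open interval: a solution on \<open>{t..}\<close> has just
  a one-sided derivative at \<open>t\<close>, and \<open>s\<^sub>1\<close> may equal
  \<open>t\<close>.\<close>

lemma gronwall_upper:
  fixes u u' :: "real \<Rightarrow> real"
  assumes "s\<^sub>1 \<le> s\<^sub>2" and cont: "continuous_on {s\<^sub>1..s\<^sub>2} u"
    and deriv: "\<And>s. s\<^sub>1 < s \<Longrightarrow> s < s\<^sub>2 \<Longrightarrow> (u has_real_derivative u' s) (at s)"
    and bound: "\<And>s. s\<^sub>1 < s \<Longrightarrow> s < s\<^sub>2 \<Longrightarrow> u' s \<le> m * u s"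
  shows "u s\<^sub>2 \<le> exp (m * (s\<^sub>2 - s\<^sub>1)) * u s\<^sub>1"
proof -
  have "u s\<^sub>2 * exp (- m * (s\<^sub>2 - s\<^sub>1)) \<le> u s\<^sub>1 * exp (- m * (s\<^sub>1 - s\<^sub>1))"
  proof (rule DERIV_nonpos_imp_decreasing_open[OF \<open>s\<^sub>1 \<le> s\<^sub>2\<close>])
    fix s assume s: "s\<^sub>1 < s" "s < s\<^sub>2"
    have "((\<lambda>s. u s * exp (- m * (s - s\<^sub>1))) has_real_derivative
        (u' s - m * u s) * exp (- m * (s - s\<^sub>1))) (at s)"
      by (auto intro!: derivative_eq_intros deriv[OF s] simp: algebra_simps)
    moreover have "(u' s - m * u s) * exp (- m * (s - s\<^sub>1)) \<le> 0"
      using bound[OF s] by (intro mult_nonpos_nonneg) auto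
    ultimately show "\<exists>y. ((\<lambda>s. u s * exp (- m * (s - s\<^sub>1))) has_real_derivative y) (at s) \<and> y \<le> 0"
      by blast
  qed (intro continuous_intros cont)
  then have "u s\<^sub>2 * exp (- m * (s\<^sub>2 - s\<^sub>1)) * exp (m * (s\<^sub>2 - s\<^sub>1)) \<le> u s\<^sub>1 * exp (m * (s\<^sub>2 - s\<^sub>1))"
    by simp
  then show ?thesis
    by (simp add: mult.assoc mult.commute[of "u s\<^sub>1"] flip: exp_add)
qed

lemma gronwall_lower:
  fixes u u' :: "real \<Rightarrow> real"
  assumes "s\<^sub>1 \<le> s\<^sub>2" and "continuous_on {s\<^sub>1..s\<^sub>2} u"
    and "\<And>s. s\<^sub>1 < s \<Longrightarrow> s < s\<^sub>2 \<Longrightarrow> (u has_real_derivative u' s) (at s)"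
    and "\<And>s. s\<^sub>1 < s \<Longrightarrow> s < s\<^sub>2 \<Longrightarrow> m * u s \<le> u' s"
  shows "exp (m * (s\<^sub>2 - s\<^sub>1)) * u s\<^sub>1 \<le> u s\<^sub>2"
  using gronwall_upper[of s\<^sub>1 s\<^sub>2 "\<lambda>s. - u s" "\<lambda>s. - u' s" m] assms
  by (auto intro: continuous_intros derivative_intros)

text \<open>Both solutions see the same input \<open>x s\<close>, so their right-hand sides differ
  only through the second argument of \<open>f\<close>. The estimate is made for the squared
  distance because the norm is not differentiable at 0.\<close>

lemma ode_solutions_distance:
  fixes f :: "real ^ 'u \<Rightarrow> real ^ 'v \<Rightarrow> real ^ 'v"
  assumes "0 \<le> a" and lip: "\<And>y. L-lipschitz_on UNIV (\<lambda>z. f y z)"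
    and g: "ode_solution_on {t..} a b f x g" and h: "ode_solution_on {t..} a b f x h"
    and s: "t \<le> s\<^sub>1" "s\<^sub>1 \<le> s\<^sub>2"
  shows "norm (g s\<^sub>2 - h s\<^sub>2) \<le> exp ((a * L - b) * (s\<^sub>2 - s\<^sub>1)) * norm (g s\<^sub>1 - h s\<^sub>1)"
    and "exp (- (a * L + b) * (s\<^sub>2 - s\<^sub>1)) * norm (g s\<^sub>1 - h s\<^sub>1) \<le> norm (g s\<^sub>2 - h s\<^sub>2)"
proof -
  define d where "d s = g s - h s" for s
  define e where "e s = f (x s) (g s) - f (x s) (h s)" for s
  have deriv: "(d has_vector_derivative (a *\<^sub>R e s - b *\<^sub>R d s)) (at s within {t..})" if "t \<le> s" for s
  proof -
    have "(g has_vector_derivative a *\<^sub>R f (x s) (g s) - b *\<^sub>R g s) (at s within {t..})"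
      and "(h has_vector_derivative a *\<^sub>R f (x s) (h s) - b *\<^sub>R h s) (at s within {t..})"
      using g h that by (auto simp: ode_solution_on_def)
    from has_vector_derivative_diff[OF this] show ?thesis
      by (simp add: d_def[abs_def] e_def algebra_simps)
  qed
  have "continuous_on {t..} d"
    using deriv has_vector_derivative_continuous by (fastforce simp: continuous_on_eq_continuous_within)
  then have cont: "continuous_on {s\<^sub>1..s\<^sub>2} (\<lambda>s. d s \<bullet> d s)"
    using s by (intro continuous_intros) (auto elim: continuous_on_subset)
  \<comment> \<open>Strict inequality puts \<open>s\<close> in the interior of \<open>{t..}\<close>,
    which turns the one-sided derivative into a two-sided one.\<close>
  have deriv_sq: "((\<lambda>s. d s \<bullet> d s) has_real_derivative 2 * (a * (d s \<bullet> e s) - b * (d s \<bullet> d s))) (at s)"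
    if "s\<^sub>1 < s" for s
  proof -
    have "(at s within {t..}) = at s"
      using that s by (intro at_within_interior) auto
    then have "(d has_vector_derivative (a *\<^sub>R e s - b *\<^sub>R d s)) (at s)"
      using deriv[of s] that s by simp
    then have "(d has_derivative (\<lambda>r. r *\<^sub>R (a *\<^sub>R e s - b *\<^sub>R d s))) (at s)"
      by (simp add: has_vector_derivative_def)
    from has_derivative_inner[OF this this] show ?thesis
      unfolding has_field_derivative_def
      by (rule has_derivative_eq_rhs) (auto simp: fun_eq_iff inner_simps algebra_simps inner_commute)
  qed
  have "norm (e s) \<le> L * norm (d s)" for s
    using lipschitz_onD[OF lip, of "g s" "h s"] by (simp add: d_def e_def dist_norm)
  \<comment> \<open>Cauchy-Schwarz combined with the Lipschitz bound. The absolute value serves both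
    directions: its two halves give \<open>upper\<close> and \<open>lower\<close>.\<close>
  then have "\<bar>d s \<bullet> e s\<bar> \<le> L * (d s \<bullet> d s)" for s
    using Cauchy_Schwarz_ineq2[of "d s" "e s"] mult_left_mono[of "norm (e s)" "L * norm (d s)" "norm (d s)"]
    by (smt (verit) mult.left_commute norm_ge_zero power2_eq_square power2_norm_eq_inner)
  then have ade: "\<bar>a * (d s \<bullet> e s)\<bar> \<le> a * (L * (d s \<bullet> d s))" for s
    using \<open>0 \<le> a\<close> by (simp add: abs_mult mult_left_mono)
  have upper: "2 * (a * (d s \<bullet> e s) - b * (d s \<bullet> d s)) \<le> 2 * (a * L - b) * (d s \<bullet> d s)" for s
    using ade[of s] by (simp add: left_diff_distrib mult.assoc)
  have lower: "2 * - (a * L + b) * (d s \<bullet> d s) \<le> 2 * (a * (d s \<bullet> e s) - b * (d s \<bullet> d s))" for s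
  proof -
    have "2 * - (a * L + b) * (d s \<bullet> d s) = 2 * (- (a * (L * (d s \<bullet> d s))) - b * (d s \<bullet> d s))"
      by algebra
    also have "\<dots> \<le> 2 * (a * (d s \<bullet> e s) - b * (d s \<bullet> d s))"
      using minus_le_iff[THEN iffD1, OF abs_le_D2[OF ade[of s]]]
      by (intro mult_left_mono diff_right_mono zero_le_numeral)
    finally show ?thesis .
  qed
  \<comment> \<open>The rate 2m for the squared distance is the rate m for the distance, so square
    roots can be taken in both bounds.\<close>
  have sq: "exp (2 * m * (s\<^sub>2 - s\<^sub>1)) * (d s\<^sub>1 \<bullet> d s\<^sub>1) = (exp (m * (s\<^sub>2 - s\<^sub>1)) * norm (d s\<^sub>1))\<^sup>2" for m
    by (simp add: power_mult_distrib power2_norm_eq_inner mult.assoc exp_double)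
  have "(norm (d s\<^sub>2))\<^sup>2 \<le> (exp ((a * L - b) * (s\<^sub>2 - s\<^sub>1)) * norm (d s\<^sub>1))\<^sup>2"
    using gronwall_upper[OF s(2) cont deriv_sq upper] by (simp only: sq power2_norm_eq_inner)
  from power2_le_imp_le[OF this]
  show "norm (g s\<^sub>2 - h s\<^sub>2) \<le> exp ((a * L - b) * (s\<^sub>2 - s\<^sub>1)) * norm (g s\<^sub>1 - h s\<^sub>1)"
    by (simp add: d_def)
  have "(exp (- (a * L + b) * (s\<^sub>2 - s\<^sub>1)) * norm (d s\<^sub>1))\<^sup>2 \<le> (norm (d s\<^sub>2))\<^sup>2"
    using gronwall_lower[OF s(2) cont deriv_sq lower] by (simp only: sq power2_norm_eq_inner)
  from power2_le_imp_le[OF this]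
  show "exp (- (a * L + b) * (s\<^sub>2 - s\<^sub>1)) * norm (g s\<^sub>1 - h s\<^sub>1) \<le> norm (g s\<^sub>2 - h s\<^sub>2)"
    by (simp add: d_def)
qed

text \<open>The difference quotient in \<open>r\<close> tends to the sensitivity, and the norm is
  continuous. This limit is what carries estimates for pairs of solutions over to the
  sensitivity.\<close>

lemma norm_sensitivity_limit:
  fixes H :: "real ^ 'b \<Rightarrow> real \<Rightarrow> real ^ 'b"
  assumes "perturbed_state H t p i \<sigma> differentiable (at 0)"
  shows "((\<lambda>r. norm (H (p + r *\<^sub>R axis i 1) (t + \<sigma>) - H p (t + \<sigma>)) / \<bar>r\<bar>)
    \<longlongrightarrow> norm (sensitivity H t p i \<sigma>)) (at 0)"
proof -
  have "(perturbed_state H t p i \<sigma> has_vector_derivative sensitivity H t p i \<sigma>) (at 0)"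
    using assms unfolding sensitivity_def by (simp add: vector_derivative_works)
  then have "((\<lambda>r. norm (perturbed_state H t p i \<sigma> r - perturbed_state H t p i \<sigma> 0
      - r *\<^sub>R sensitivity H t p i \<sigma>) / norm r) \<longlongrightarrow> 0) (at 0)"
    by (simp add: has_vector_derivative_def has_derivative_at)
  moreover have "\<forall>\<^sub>F r in at 0. norm (perturbed_state H t p i \<sigma> r - perturbed_state H t p i \<sigma> 0
      - r *\<^sub>R sensitivity H t p i \<sigma>) / norm r
    = norm ((perturbed_state H t p i \<sigma> r - perturbed_state H t p i \<sigma> 0) /\<^sub>R r - sensitivity H t p i \<sigma>)"
  proof (rule eventually_mono[OF eventually_neq_at_within])
    fix r :: real assume "r \<noteq> 0"
    \<comment> \<open>Scaling by \<open>inverse r\<close> turns the relative remainder of the linear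
      approximation into the distance from the difference quotient to its limit.\<close>
    then have "norm (v - r *\<^sub>R w) / norm r = norm (v /\<^sub>R r - w)" for v w :: "real ^ 'b"
      using norm_scaleR[of "inverse r" "v - r *\<^sub>R w"]
      by (simp add: scaleR_diff_right divide_inverse mult.commute del: norm_scaleR)
    then show "norm (perturbed_state H t p i \<sigma> r - perturbed_state H t p i \<sigma> 0
        - r *\<^sub>R sensitivity H t p i \<sigma>) / norm r
      = norm ((perturbed_state H t p i \<sigma> r - perturbed_state H t p i \<sigma> 0) /\<^sub>R r - sensitivity H t p i \<sigma>)" .
  qed
  ultimately have "((\<lambda>r. norm ((perturbed_state H t p i \<sigma> r - perturbed_state H t p i \<sigma> 0) /\<^sub>R r
      - sensitivity H t p i \<sigma>)) \<longlongrightarrow> 0) (at 0)"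
    by (rule Lim_transform_eventually)
  then have "((\<lambda>r. (perturbed_state H t p i \<sigma> r - perturbed_state H t p i \<sigma> 0) /\<^sub>R r)
      \<longlongrightarrow> sensitivity H t p i \<sigma>) (at 0)"
    by (rule LIM_zero_cancel[OF tendsto_norm_zero_cancel])
  moreover have "norm (v /\<^sub>R r) = norm v / \<bar>r\<bar>" for v :: "real ^ 'b" and r
    by (simp add: divide_inverse mult.commute)
  ultimately show ?thesis
    using tendsto_norm by (force simp only: perturbed_state_def scaleR_zero_left add_0_right)
qed

lemma sensitivity_bounds:
  fixes f :: "real ^ 'u \<Rightarrow> real ^ 'v \<Rightarrow> real ^ 'v"
  assumes "0 \<le> a" and lip: "\<And>y. L-lipschitz_on UNIV (\<lambda>z. f y z)"
    and fam: "solution_family t a b f x H"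
    and \<tau>: "0 \<le> \<tau>" "perturbed_state H t p i \<tau> differentiable (at 0)"
  shows sensitivity_decay: "\<And>\<sigma>. \<tau> \<le> \<sigma> \<Longrightarrow> perturbed_state H t p i \<sigma> differentiable (at 0) \<Longrightarrow>
      norm (sensitivity H t p i \<sigma>) \<le> exp ((a * L - b) * (\<sigma> - \<tau>)) * norm (sensitivity H t p i \<tau>)"
    and sensitivity_pos: "0 < norm (sensitivity H t p i \<tau>)"
proof -
  let ?q = "\<lambda>r. p + r *\<^sub>R axis i 1"
  have sol: "ode_solution_on {t..} a b f x (H q)" and init: "H q t = q" for q
    using fam by (auto simp: solution_family_def)
  note dist = ode_solutions_distance[OF \<open>0 \<le> a\<close> lip sol sol]
  show "norm (sensitivity H t p i \<sigma>) \<le> exp ((a * L - b) * (\<sigma> - \<tau>)) * norm (sensitivity H t p i \<tau>)"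
    if "\<tau> \<le> \<sigma>" "perturbed_state H t p i \<sigma> differentiable (at 0)" for \<sigma>
  proof (rule tendsto_le)
    show "((\<lambda>r. exp ((a * L - b) * (\<sigma> - \<tau>)) * (norm (H (?q r) (t + \<tau>) - H p (t + \<tau>)) / \<bar>r\<bar>))
        \<longlongrightarrow> exp ((a * L - b) * (\<sigma> - \<tau>)) * norm (sensitivity H t p i \<tau>)) (at 0)"
      by (intro tendsto_intros norm_sensitivity_limit \<tau>)
    \<comment> \<open>This holds for every \<open>r\<close>: at \<open>r = 0\<close> both quotients
      are 0, since division by zero gives 0.\<close>
    show "\<forall>\<^sub>F r in at 0. norm (H (?q r) (t + \<sigma>) - H p (t + \<sigma>)) / \<bar>r\<bar>
        \<le> exp ((a * L - b) * (\<sigma> - \<tau>)) * (norm (H (?q r) (t + \<tau>) - H p (t + \<tau>)) / \<bar>r\<bar>)"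
      using dist(1)[of "t + \<tau>" "t + \<sigma>"] \<tau> that
      by (intro always_eventually) (auto intro!: divide_right_mono)
  qed (use that in \<open>auto intro: norm_sensitivity_limit\<close>)
  \<comment> \<open>At time \<open>t\<close> the perturbed and unperturbed states are exactly
    \<open>\<bar>r\<bar>\<close> apart, so the quotient has a positive lower bound independent of
    \<open>r\<close>, which survives the limit. Here \<open>r = 0\<close> must be excluded.\<close>
  have "exp (- (a * L + b) * \<tau>) \<le> norm (sensitivity H t p i \<tau>)"
  proof (rule tendsto_lowerbound[OF norm_sensitivity_limit[OF \<tau>(2)]])
    show "\<forall>\<^sub>F r in at 0. exp (- (a * L + b) * \<tau>) \<le> norm (H (?q r) (t + \<tau>) - H p (t + \<tau>)) / \<bar>r\<bar>"
    proof (rule eventually_mono[OF eventually_neq_at_within])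
      fix r :: real assume "r \<noteq> 0"
      then show "exp (- (a * L + b) * \<tau>) \<le> norm (H (?q r) (t + \<tau>) - H p (t + \<tau>)) / \<bar>r\<bar>"
        using dist(2)[of t "t + \<tau>" "?q r" p] \<tau> by (simp add: init pos_le_divide_eq norm_axis_1)
    qed
  qed auto
  then show "0 < norm (sensitivity H t p i \<tau>)"
    by (smt (verit) exp_gt_zero)
qed

text \<open>The right difference quotients are ordered, as the base values agree and the
  denominators are positive; the order passes to the limit.\<close>

lemma derivative_le_of_right_le:
  fixes g k :: "real \<Rightarrow> real"
  assumes "(g has_real_derivative g') (at_right \<tau>)" and "(k has_real_derivative k') (at_right \<tau>)"
    and "g \<tau> = k \<tau>" and "\<forall>\<^sub>F \<sigma> in at_right \<tau>. g \<sigma> \<le> k \<sigma>"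
  shows "g' \<le> k'"
proof (rule tendsto_le)
  show "((\<lambda>\<sigma>. (g \<sigma> - g \<tau>) / (\<sigma> - \<tau>)) \<longlongrightarrow> g') (at_right \<tau>)"
    and "((\<lambda>\<sigma>. (k \<sigma> - k \<tau>) / (\<sigma> - \<tau>)) \<longlongrightarrow> k') (at_right \<tau>)"
    using assms(1,2) by (auto simp: has_field_derivative_iff)
  show "\<forall>\<^sub>F \<sigma> in at_right \<tau>. (g \<sigma> - g \<tau>) / (\<sigma> - \<tau>) \<le> (k \<sigma> - k \<tau>) / (\<sigma> - \<tau>)"
    using assms(4) eventually_at_right_less[of \<tau>]
    by eventually_elim (auto simp: assms(3) intro: divide_right_mono)
qed (rule trivial_limit_at_right_real)

theorem theorem4p8:
  fixes a b L\<^sub>x L\<^sub>h t \<tau> :: real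
    and f :: "real ^ 'u \<Rightarrow> real ^ 'v \<Rightarrow> real ^ 'v"
    and x :: "real \<Rightarrow> real ^ 'u"
    and H :: "real ^ 'v \<Rightarrow> real \<Rightarrow> real ^ 'v"
    and p :: "real ^ 'v"
    and i :: 'v
  assumes "a \<in> {0<..<1}" and "b \<in> {0<..<1}" and "L\<^sub>h \<in> {0<..<1}" and "a * L\<^sub>h < b"
    and "\<And>z. L\<^sub>x-lipschitz_on UNIV (\<lambda>y. f y z)"
    and "\<And>y. L\<^sub>h-lipschitz_on UNIV (\<lambda>z. f y z)"
    and "f 0 0 = 0"
    and "solution_family t a b f x H"
    and "\<tau> \<ge> 0"
    and "\<forall>\<^sub>F \<sigma> in nhds \<tau>. \<sigma> \<ge> 0 \<longrightarrow> perturbed_state H t p i \<sigma> differentiable (at 0)"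
    and "(\<lambda>\<sigma>. norm (sensitivity H t p i \<sigma>)) differentiable (at \<tau> within {0..})"
  shows "vector_derivative (\<lambda>\<sigma>. norm (sensitivity H t p i \<sigma>)) (at \<tau> within {0..}) < 0"
proof -
  let ?N = "\<lambda>\<sigma>. norm (sensitivity H t p i \<sigma>)"
  let ?D = "vector_derivative ?N (at \<tau> within {0..})"
  note ev = assms(10)
  have diff: "perturbed_state H t p i \<tau> differentiable (at 0)"
    using eventually_nhds_x_imp_x[OF ev] \<open>\<tau> \<ge> 0\<close> by simp
  have "0 \<le> a" using assms(1) by simp
  note bounds = sensitivity_bounds[OF \<open>0 \<le> a\<close> assms(6,8) \<open>\<tau> \<ge> 0\<close> diff]
  have "{\<tau><..} \<subseteq> {0..}"
    using \<open>\<tau> \<ge> 0\<close> by auto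
  then have "(at \<tau> within {0..}) \<noteq> bot"
    using trivial_limit_at_right_real[of \<tau>] at_le[of "{\<tau><..}" "{0..}" \<tau>] by (auto simp: bot_unique)
  then have "(?N has_real_derivative ?D) (at \<tau> within {0..})"
    using assms(11) by (simp add: has_real_derivative_iff_has_vector_derivative vector_derivative_works)
  \<comment> \<open>The decay bound compares only times from \<tau> onwards. Restricting to the
    right also treats \<tau> = 0 and \<tau> > 0 alike.\<close>
  then have "(?N has_real_derivative ?D) (at_right \<tau>)"
    using \<open>\<tau> \<ge> 0\<close> by (auto elim: DERIV_subset)
  moreover have "((\<lambda>\<sigma>. exp ((a * L\<^sub>h - b) * (\<sigma> - \<tau>)) * ?N \<tau>) has_real_derivative (a * L\<^sub>h - b) * ?N \<tau>)
      (at_right \<tau>)"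
    by (auto intro!: derivative_eq_intros)
  moreover have "\<forall>\<^sub>F \<sigma> in at_right \<tau>. ?N \<sigma> \<le> exp ((a * L\<^sub>h - b) * (\<sigma> - \<tau>)) * ?N \<tau>"
    using filter_leD[OF at_within_le_nhds ev] eventually_at_right_less[of \<tau>]
    by eventually_elim (use \<open>\<tau> \<ge> 0\<close> bounds(1) in auto)
  ultimately have "?D \<le> (a * L\<^sub>h - b) * ?N \<tau>"
    by (intro derivative_le_of_right_le) auto
  \<comment> \<open>Strictness needs both \<open>a * L\<^sub>h < b\<close> and the positivity of the
    sensitivity's norm at \<tau>.\<close>
  also have "\<dots> < 0"
    using assms(4) bounds(2) by (intro mult_neg_pos) auto
  finally show ?thesis .
qed

end
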